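(* Let $m>1$ and $n\neq0$ be real numbers, and define $f:\mathbb{R}\to\mathbb{R}$ by $f(x)=|x|\left(m+\sin\frac1{nx}\right)$ for $x\neq0$ and $f(0)=0$. Let $C=m-1>0$. Then: (a) For every $\lambda>0$ and every $x$ with $|x|<C\lambda$, $P_\lambda f(x)=\{0\}$ and $e_\lambda f(x)=\frac1{2\lambda}x^2$. Consequently, $P_\lambda f$ is Lipschitz and $e_\lambda f$ is differentiable around $0$. (b) $[-C,C]\subseteq\hat\partial f(0)$, and $\partial f(0)=\mathbb{R}$. (c) $f$ is not prox-regular at $\bar x=0$ for $\bar v=0\in\partial f(0)$.
   Context: For $f:\mathbb{R}\to\mathbb{R}$ and $\lambda>0$: $e_\lambda f(x)=\inf_{w}\left\{f(w)+\frac1{2\lambda}(w-x)^2\right\}$ (Moreau envelope) and $P_\lambda f(x)=\arg\min_{w}\left\{f(w)+\frac1{2\lambda}(w-x)^2\right\}$ (proximal mapping, set-valued). Regular subgradients: $v\in\hat\partial f(\bar x)$ iff $\liminf_{x\to\bar x,\,x\neq\bar x}\frac{f(x)-f(\bar x)-v(x-\bar x)}{|x-\bar x|}\ge0$. General (limiting) subgradients: $v\in\partial f(\bar x)$ iff there exist sequences $x^\nu\to\bar x$ with $f(x^\nu)\to f(\bar x)$ and $v^\nu\to v$ with $v^\nu\in\hat\partial f(x^\nu)$. Prox-regularity: $f$ is prox-regular at $\bar x$ for $\bar v$ if $f$ is finite and locally lower semicontinuous at $\bar x$ with $\bar v\in\partial f(\bar x)$, and there exist $\varepsilon>0$ and $\rho\ge0$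 such that $f(x')\ge f(x)+v(x'-x)-\frac{\rho}{2}|x'-x|^2$ for all $x'$ with $|x'-\bar x|<\varepsilon$, whenever $v\in\partial f(x)$, $|v-\bar v|<\varepsilon$, $|x-\bar x|<\varepsilon$, $f(x)<f(\bar x)+\varepsilon$. *)

theory Defs
  imports "HOL-Analysis.Analysis"
begin

text \<open>The infimum is taken in the reals, so it is meaningful whenever the objective is
  bounded below in \<open>w\<close> (in particular for nonnegative \<open>f\<close>).\<close>

definition moreau_envelope :: "real \<Rightarrow> (real \<Rightarrow> real) \<Rightarrow> real \<Rightarrow> real" where
  "moreau_envelope lam f x = (INF w. f w + 1 / (2 * lam) * (w - x)\<^sup>2)"

definition proximal_map :: "real \<Rightarrow> (real \<Rightarrow> real) \<Rightarrow> real \<Rightarrow> real set" where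
  "proximal_map lam f x =
     {w. is_arg_min (\<lambda>u. f u + 1 / (2 * lam) * (u - x)\<^sup>2) (\<lambda>u. True) w}"

definition regular_subgradients :: "(real \<Rightarrow> real) \<Rightarrow> real \<Rightarrow> real set" where
  "regular_subgradients f xbar =
     {v. Liminf (at xbar) (\<lambda>x. ereal ((f x - f xbar - v * (x - xbar)) / \<bar>x - xbar\<bar>)) \<ge> 0}"

definition limiting_subgradients :: "(real \<Rightarrow> real) \<Rightarrow> real \<Rightarrow> real set" where
  "limiting_subgradients f xbar =
     {v. \<exists>xs vs. xs \<longlonglongrightarrow> xbar \<and> (\<lambda>k. f (xs k)) \<longlonglongrightarrow> f xbar \<and> vs \<longlonglongrightarrow> v \<and>
           (\<forall>k::nat. vs k \<in> regular_subgradients f (xs k))}"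

text \<open>Local lower semicontinuity in the sense of Rockafellar and Wets, \<^emph>\<open>Variational Analysis\<close>:
  the truncated sublevel sets near the point are closed.\<close>

definition locally_lsc_at :: "(real \<Rightarrow> real) \<Rightarrow> real \<Rightarrow> bool" where
  "locally_lsc_at f xbar \<longleftrightarrow>
     (\<exists>\<epsilon>>0. \<forall>\<alpha> \<le> f xbar + \<epsilon>. closed {x \<in> cball xbar \<epsilon>. f x \<le> \<alpha>})"

text \<open>Finiteness at \<open>xbar\<close> is automatic for real-valued functions.\<close>

definition prox_regular :: "(real \<Rightarrow> real) \<Rightarrow> real \<Rightarrow> real \<Rightarrow> bool" where
  "prox_regular f xbar vbar \<longleftrightarrow>
     locally_lsc_at f xbar \<and> vbar \<in> limiting_subgradients f xbar \<and>
     (\<exists>\<epsilon>>0. \<exists>\<rho>\<ge>0. \<forall>x v. v \<in> limiting_subgradients f x \<and> \<bar>v - vbar\<bar> < \<epsilon> \<and>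
          \<bar>x - xbar\<bar> < \<epsilon> \<and> f x < f xbar + \<epsilon> \<longrightarrow>
        (\<forall>x'. \<bar>x' - xbar\<bar> < \<epsilon> \<longrightarrow>
           f x' \<ge> f x + v * (x' - x) - \<rho> / 2 * \<bar>x' - x\<bar>\<^sup>2))"

text \<open>A set-valued map is Lipschitz around a point if, on some neighbourhood of it, the map is
  single-valued and Lipschitz continuous.\<close>

definition lipschitz_around :: "(real \<Rightarrow> real set) \<Rightarrow> real \<Rightarrow> bool" where
  "lipschitz_around S xbar \<longleftrightarrow>
     (\<exists>\<epsilon>>0. \<exists>p K. (\<forall>x\<in>ball xbar \<epsilon>. S x = {p x}) \<and> K-lipschitz_on (ball xbar \<epsilon>) p)"

definition differentiable_around :: "(real \<Rightarrow> real) \<Rightarrow> real \<Rightarrow> bool" where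
  "differentiable_around g xbar \<longleftrightarrow> (\<exists>\<epsilon>>0. \<forall>x\<in>ball xbar \<epsilon>. g differentiable (at x))"

end

theory Submission
  imports Defs
begin

text \<open>Since \<open>f w \<ge> C * \<bar>w\<bar>\<close>, the origin is a sharp minimum of \<open>f\<close>. This yields the proximal map
  and the envelope for \<open>\<bar>x\<bar> < C * lam\<close>, and the regular subgradients at \<open>0\<close>.
  On the positive half-line \<open>f' x = m + sin t - t * cos t\<close> with \<open>t = 1 / (n * x)\<close>, which by the
  intermediate value theorem takes every real value at points \<open>x\<close> arbitrarily close to \<open>0\<close>; hence
  every real number is a limiting subgradient at \<open>0\<close>.
  At critical points \<open>x\<close> tending to \<open>0\<close>, the prox-regularity inequality for \<open>v = 0\<close>, tested at
  \<open>x' = 0\<close>, would give \<open>C * x \<le> f x \<le> \<rho> / 2 * x\<^sup>2\<close>, which is impossible for small \<open>x\<close>.\<close>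

section \<open>The oscillating function, its limit at the origin and its derivative\<close>

text \<open>The factor \<open>\<bar>x\<bar>\<close> vanishes at the origin, so the formula also
  gives the prescribed value there and needs no case distinction.\<close>

definition oscillating_abs :: "real \<Rightarrow> real \<Rightarrow> real \<Rightarrow> real" where
  "oscillating_abs m n x = \<bar>x\<bar> * (m + sin (1 / (n * x)))"

lemma oscillating_abs_0 [simp]: "oscillating_abs m n 0 = 0"
  by (simp add: oscillating_abs_def)

lemma oscillating_abs_ge: "(m - 1) * \<bar>x\<bar> \<le> oscillating_abs m n x"
proof -
  have "m - 1 \<le> m + sin (1 / (n * x))"
    using sin_ge_minus_one[of "1 / (n * x)"] by linarith
  then show ?thesis
    unfolding oscillating_abs_def by (metis abs_ge_zero mult.commute mult_left_mono)
qed

lemma tendsto_oscillating_abs_0: "(oscillating_abs m n \<longlongrightarrow> 0) (at 0)"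
proof (rule Lim_null_comparison)
  show "\<forall>\<^sub>F x in at 0. norm (oscillating_abs m n x) \<le> \<bar>x\<bar> * (\<bar>m\<bar> + 1)"
  proof (intro always_eventually allI)
    fix x :: real
    have "\<bar>m + sin (1 / (n * x))\<bar> \<le> \<bar>m\<bar> + 1"
      using abs_sin_le_one[of "1 / (n * x)"] by linarith
    then show "norm (oscillating_abs m n x) \<le> \<bar>x\<bar> * (\<bar>m\<bar> + 1)"
      by (simp add: oscillating_abs_def abs_mult mult_left_mono)
  qed
  show "((\<lambda>x. \<bar>x\<bar> * (\<bar>m\<bar> + 1)) \<longlongrightarrow> 0) (at (0::real))"
    by (auto intro!: tendsto_eq_intros)
qed

lemma DERIV_oscillating_abs:
  assumes "x > 0" "n \<noteq> 0"
  shows "(oscillating_abs m n has_real_derivative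
           m + sin (1 / (n * x)) - 1 / (n * x) * cos (1 / (n * x))) (at x)"
proof -
  have "((\<lambda>x. x * (m + sin (1 / (n * x)))) has_real_derivative
           m + sin (1 / (n * x)) - 1 / (n * x) * cos (1 / (n * x))) (at x)"
    using assms by (auto intro!: derivative_eq_intros simp: field_simps power2_eq_square)
  \<comment> \<open>On the open half-line of positive reals \<open>\<bar>x\<bar>\<close> is
    \<open>x\<close>, so the derivative carries over.\<close>
  then show ?thesis
    by (rule has_field_derivative_transform_within_open[where S = "{0<..}"])
       (use assms in \<open>auto simp: oscillating_abs_def\<close>)
qed

text \<open>At \<open>a = 2 * pi * k\<close> the left side equals \<open>- a\<close>, and at
  \<open>a + pi\<close> it equals \<open>a + pi\<close>; for large \<open>k\<close> these two values
  enclose \<open>c\<close>.\<close>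

lemma sin_minus_id_cos_unbounded_solutions:
  fixes c K :: real
  shows "\<exists>s\<ge>K. sin s - s * cos s = c"
proof -
  \<comment> \<open>As \<open>2 * pi \<ge> 1\<close>, this choice makes \<open>a\<close> exceed both
    \<open>K\<close>, placing the solution far out, and \<open>\<bar>c\<bar>\<close>, as the
    intermediate value theorem requires.\<close>
  obtain k :: nat where k: "real k > \<bar>K\<bar> + \<bar>c\<bar>"
    using reals_Archimedean2 by blast
  define a where "a = 2 * pi * real k"
  have "real k * 1 \<le> real k * (2 * pi)"
    using pi_ge_two by (intro mult_left_mono) auto
  then have a: "a > \<bar>K\<bar> + \<bar>c\<bar>"
    using k by (simp add: a_def mult.commute)
  have trig: "sin a = 0" "cos a = 1"
    using sin_2npi[of k] cos_2npi[of k] by (simp_all add: a_def mult_ac)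
  have bounds: "- a \<le> c" "c \<le> a + pi"
    using a pi_gt_zero by linarith+
  have "\<exists>s\<ge>a. s \<le> a + pi \<and> sin s - s * cos s = c"
  proof (rule IVT')
    show "sin a - a * cos a \<le> c" "c \<le> sin (a + pi) - (a + pi) * cos (a + pi)"
      using bounds by (simp_all add: trig)
  qed (auto intro!: continuous_intros)
  then obtain s where "s \<ge> a" "sin s - s * cos s = c"
    by blast
  moreover have "K \<le> a"
    using a by linarith
  ultimately show ?thesis
    by (intro exI[of _ s]) simp
qed

text \<open>With \<open>x = 1 / (\<bar>n\<bar> * s)\<close> the parity of sine and cosine turns the
  derivative into \<open>m + sgn n * (sin s - s * cos s)\<close>, and large \<open>s\<close> means
  small \<open>x\<close>.\<close>

lemma DERIV_oscillating_abs_arbitrary_near_0: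
  assumes "n \<noteq> 0" "\<delta> > 0"
  shows "\<exists>x. 0 < x \<and> x < \<delta> \<and> (oscillating_abs m n has_real_derivative v) (at x)"
proof -
  \<comment> \<open>The summand \<open>1\<close> makes the lower bound on \<open>s\<close> strict,
    which gives \<open>x < \<delta>\<close>.\<close>
  obtain s where s: "s \<ge> 1 / (\<bar>n\<bar> * \<delta>) + 1" "sin s - s * cos s = sgn n * (v - m)"
    using sin_minus_id_cos_unbounded_solutions by blast
  have nd: "1 / (\<bar>n\<bar> * \<delta>) > 0"
    using assms by simp
  then have "s > 0" "s > 1 / (\<bar>n\<bar> * \<delta>)"
    using s(1) by linarith+
  define x where "x = 1 / (\<bar>n\<bar> * s)"
  have x: "0 < x" "x < \<delta>"
    using assms \<open>s > 0\<close> \<open>s > 1 / (\<bar>n\<bar> * \<delta>)\<close> by (auto simp: x_def field_simps)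
  have t: "1 / (n * x) = sgn n * s"
    using assms \<open>s > 0\<close> by (auto simp: x_def field_simps sgn_if)
  have "m + sin (sgn n * s) - sgn n * s * cos (sgn n * s) = v"
    using assms(1) s(2) by (auto simp: sgn_if split: if_splits)
  then show ?thesis
    using DERIV_oscillating_abs[OF x(1) assms(1), of m] x t by auto
qed

section \<open>Regular and limiting subgradients in general\<close>

lemma DERIV_imp_regular_subgradient:
  assumes "(f has_real_derivative v) (at x)"
  shows "v \<in> regular_subgradients f x"
proof -
  have "((\<lambda>y. \<bar>(f y - f x - v * (y - x)) / \<bar>y - x\<bar>\<bar>) \<longlongrightarrow> 0) (at x)"
    using assms unfolding has_field_derivative_def has_derivative_iff_norm by simp
  then have "((\<lambda>y. (f y - f x - v * (y - x)) / \<bar>y - x\<bar>) \<longlongrightarrow> 0) (at x)"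
    by (rule tendsto_rabs_zero_cancel)
  then have "((\<lambda>y. ereal ((f y - f x - v * (y - x)) / \<bar>y - x\<bar>)) \<longlongrightarrow> ereal 0) (at x)"
    by simp
  then have "Liminf (at x) (\<lambda>y. ereal ((f y - f x - v * (y - x)) / \<bar>y - x\<bar>)) = ereal 0"
    by (intro lim_imp_Liminf) auto
  then show ?thesis
    by (simp add: regular_subgradients_def)
qed

lemma regular_subgradients_subset_limiting:
  "regular_subgradients f x \<subseteq> limiting_subgradients f x"
proof
  fix v assume "v \<in> regular_subgradients f x"
  then show "v \<in> limiting_subgradients f x"
    unfolding limiting_subgradients_def
    by (intro CollectI exI[of _ "\<lambda>_. x"] exI[of _ "\<lambda>_. v"]) auto
qed

section \<open>Functions with a sharp minimum at the origin\<close>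

text \<open>For \<open>\<bar>v\<bar> \<le> C\<close> the difference quotient is nonnegative
  everywhere, not only in the limit.\<close>

lemma sharp_minimum_regular_subgradients:
  assumes "f 0 = 0" and ge: "\<And>w. C * \<bar>w\<bar> \<le> f w"
  shows "{-C..C} \<subseteq> regular_subgradients f 0"
proof
  fix v assume "v \<in> {-C..C}"
  then have "\<bar>v\<bar> \<le> C"
    by auto
  have "0 \<le> f x - v * x" for x
  proof -
    have "v * x \<le> \<bar>v\<bar> * \<bar>x\<bar>"
      by (metis abs_ge_self abs_mult)
    also have "\<dots> \<le> C * \<bar>x\<bar>"
      using \<open>\<bar>v\<bar> \<le> C\<close> by (simp add: mult_right_mono)
    finally show ?thesis
      using ge[of x] by linarith
  qed
  then show "v \<in> regular_subgradients f 0"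
    unfolding regular_subgradients_def
    by (intro CollectI Liminf_bounded always_eventually) (auto simp: assms(1))
qed

text \<open>After multiplication by \<open>2 * lam\<close> and expansion of the square, it suffices
  that \<open>w * x < f w * lam\<close>; this follows from \<open>\<bar>x\<bar> < C * lam\<close>
  and the sharp growth of \<open>f\<close>.\<close>

lemma sharp_minimum_prox_strict:
  fixes f :: "real \<Rightarrow> real"
  assumes ge: "\<And>w. C * \<bar>w\<bar> \<le> f w" and "lam > 0" "\<bar>x\<bar> < C * lam" "w \<noteq> 0"
  shows "1 / (2 * lam) * x\<^sup>2 < f w + 1 / (2 * lam) * (w - x)\<^sup>2"
proof -
  have "w * x \<le> \<bar>w\<bar> * \<bar>x\<bar>"
    by (metis abs_ge_self abs_mult)
  also have "\<dots> < \<bar>w\<bar> * (C * lam)"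
    using assms by simp
  also have "\<dots> \<le> f w * lam"
    using mult_right_mono[OF ge[of w], of lam] \<open>lam > 0\<close> by (simp add: mult_ac)
  finally have "w * x < f w * lam" .
  moreover have "w\<^sup>2 > 0"
    using \<open>w \<noteq> 0\<close> by simp
  moreover have "(w - x)\<^sup>2 = w\<^sup>2 + x\<^sup>2 - 2 * (w * x)"
    by (simp add: power2_diff)
  ultimately have "x\<^sup>2 < 2 * (f w * lam) + (w - x)\<^sup>2"
    by linarith
  then show ?thesis
    using \<open>lam > 0\<close> by (simp add: field_simps)
qed

lemma sharp_minimum_proximal_map:
  assumes "f 0 = 0" and "\<And>w. C * \<bar>w\<bar> \<le> f w" and "lam > 0" "\<bar>x\<bar> < C * lam"
  shows "proximal_map lam f x = {0}"
proof -
  have strict: "f 0 + 1 / (2 * lam) * (0 - x)\<^sup>2 < f w + 1 / (2 * lam) * (w - x)\<^sup>2"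
    if "w \<noteq> 0" for w
    using sharp_minimum_prox_strict[OF assms(2-4) that] assms(1) by simp
  then have "\<not> f w + 1 / (2 * lam) * (w - x)\<^sup>2 < f 0 + 1 / (2 * lam) * (0 - x)\<^sup>2" for w
    by (cases "w = 0") (auto simp: not_less intro: less_imp_le)
  then show ?thesis
    unfolding proximal_map_def is_arg_min_def using strict by blast
qed

lemma sharp_minimum_moreau_envelope:
  assumes "f 0 = 0" and "\<And>w. C * \<bar>w\<bar> \<le> f w" and "lam > 0" "\<bar>x\<bar> < C * lam"
  shows "moreau_envelope lam f x = 1 / (2 * lam) * x\<^sup>2"
  unfolding moreau_envelope_def
proof (rule cInf_eq_minimum)
  show "1 / (2 * lam) * x\<^sup>2 \<in> range (\<lambda>w. f w + 1 / (2 * lam) * (w - x)\<^sup>2)"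
    using assms(1) by (intro range_eqI[of _ _ 0]) simp
  fix y assume "y \<in> range (\<lambda>w. f w + 1 / (2 * lam) * (w - x)\<^sup>2)"
  then obtain w where w: "y = f w + 1 / (2 * lam) * (w - x)\<^sup>2"
    by blast
  show "1 / (2 * lam) * x\<^sup>2 \<le> y"
  proof (cases "w = 0")
    case True
    then show ?thesis using w assms(1) by simp
  next
    case False
    then show ?thesis using sharp_minimum_prox_strict[OF assms(2-4) False] w by simp
  qed
qed

lemma sharp_minimum_lipschitz_around:
  assumes "f 0 = 0" and "\<And>w. C * \<bar>w\<bar> \<le> f w" and "C > 0" "lam > 0"
  shows "lipschitz_around (proximal_map lam f) 0"
  unfolding lipschitz_around_def
proof (intro exI conjI ballI)
  show "C * lam > 0"
    using assms by simp
  show "proximal_map lam f x = {0}" if "x \<in> ball 0 (C * lam)" for x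
    using sharp_minimum_proximal_map[of f C lam x] assms that by simp
  show "0-lipschitz_on (ball 0 (C * lam)) (\<lambda>_. 0)"
    by (rule lipschitz_on_constant)
qed

lemma sharp_minimum_differentiable_around:
  assumes "f 0 = 0" and "\<And>w. C * \<bar>w\<bar> \<le> f w" and "C > 0" "lam > 0"
  shows "differentiable_around (moreau_envelope lam f) 0"
  unfolding differentiable_around_def
proof (intro exI conjI ballI)
  show "C * lam > 0"
    using assms by simp
  fix x :: real assume x: "x \<in> ball 0 (C * lam)"
  have "((\<lambda>x. 1 / (2 * lam) * x\<^sup>2) has_real_derivative 1 / (2 * lam) * (2 * x)) (at x)"
    using \<open>lam > 0\<close> by (auto intro!: derivative_eq_intros)
  \<comment> \<open>The envelope agrees with the quadratic on a whole open ball, so it inherits the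
    derivative.\<close>
  then have "(moreau_envelope lam f has_real_derivative 1 / (2 * lam) * (2 * x)) (at x)"
    by (rule has_field_derivative_transform_within_open[OF _ open_ball x])
       (use sharp_minimum_moreau_envelope[of f C lam] assms in simp)
  then show "moreau_envelope lam f differentiable (at x)"
    using real_differentiable_def by blast
qed

section \<open>Limiting subgradients at the origin and failure of prox-regularity\<close>

lemma limiting_subgradients_oscillating_abs_0:
  assumes "n \<noteq> 0"
  shows "limiting_subgradients (oscillating_abs m n) 0 = UNIV"
proof -
  have "v \<in> limiting_subgradients (oscillating_abs m n) 0" for v
  proof -
    have "\<exists>x. 0 < x \<and> x < inverse (real (Suc k)) \<and>
            (oscillating_abs m n has_real_derivative v) (at x)" for k
      using DERIV_oscillating_abs_arbitrary_near_0[OF assms] by simp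
    then obtain xs where xs: "\<And>k. 0 < xs k" "\<And>k. xs k < inverse (real (Suc k))"
      "\<And>k. (oscillating_abs m n has_real_derivative v) (at (xs k))"
      by metis
    have lim: "xs \<longlonglongrightarrow> 0"
      by (rule Lim_null_comparison[OF _ LIMSEQ_inverse_real_of_nat])
         (use xs(1,2) in \<open>auto intro!: always_eventually less_imp_le simp: abs_of_pos\<close>)
    \<comment> \<open>The limit at the origin is a punctured one, so it composes with
      \<open>xs\<close> because every \<open>xs k\<close> is nonzero.\<close>
    have "(\<lambda>k. oscillating_abs m n (xs k)) \<longlonglongrightarrow> oscillating_abs m n 0"
      using filterlim_compose[OF tendsto_oscillating_abs_0 filterlim_atI[OF lim]] xs(1)
      by (simp add: less_imp_neq[symmetric])
    then show ?thesis
      unfolding limiting_subgradients_def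
      using lim DERIV_imp_regular_subgradient[OF xs(3)]
      by (intro CollectI exI[of _ xs] exI[of _ "\<lambda>_. v"]) auto
  qed
  then show ?thesis
    by blast
qed

lemma not_prox_regular_oscillating_abs:
  assumes "m > 1" "n \<noteq> 0"
  shows "\<not> prox_regular (oscillating_abs m n) 0 0"
proof
  let ?f = "oscillating_abs m n"
  assume "prox_regular ?f 0 0"
  then obtain \<epsilon> \<rho> where "\<epsilon> > 0" "\<rho> \<ge> 0" and
    ineq: "\<And>x v x'. v \<in> limiting_subgradients ?f x \<Longrightarrow> \<bar>v\<bar> < \<epsilon> \<Longrightarrow> \<bar>x\<bar> < \<epsilon> \<Longrightarrow> ?f x < \<epsilon> \<Longrightarrow>
      \<bar>x'\<bar> < \<epsilon> \<Longrightarrow> ?f x' \<ge> ?f x + v * (x' - x) - \<rho> / 2 * \<bar>x' - x\<bar>\<^sup>2"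
    unfolding prox_regular_def by auto
  have "\<forall>\<^sub>F x in at 0. ?f x < \<epsilon>"
    using tendsto_oscillating_abs_0 \<open>\<epsilon> > 0\<close> by (rule order_tendstoD)
  then obtain d where "d > 0" and d: "\<And>x. x \<noteq> 0 \<Longrightarrow> \<bar>x\<bar> < d \<Longrightarrow> ?f x < \<epsilon>"
    unfolding eventually_at by (auto simp: dist_real_def)
  \<comment> \<open>The bounds \<open>d\<close> and \<open>\<epsilon>\<close> make the
    prox-regularity inequality applicable; the last bound forces
    \<open>x * (\<rho> + 1) < m - 1\<close>, and its denominator is positive even for
    \<open>\<rho> = 0\<close>.\<close>
  define \<delta> where "\<delta> = min (min d \<epsilon>) ((m - 1) / (\<rho> + 1))"
  have "\<delta> > 0"
    using \<open>d > 0\<close> \<open>\<epsilon> > 0\<close> \<open>\<rho> \<ge> 0\<close> assms by (simp add: \<delta>_def)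
  then obtain x where x: "0 < x" "x < \<delta>" "(?f has_real_derivative 0) (at x)"
    using DERIV_oscillating_abs_arbitrary_near_0[OF assms(2)] by blast
  have "0 \<in> limiting_subgradients ?f x"
    using DERIV_imp_regular_subgradient[OF x(3)] regular_subgradients_subset_limiting by blast
  then have "?f x \<le> \<rho> / 2 * x\<^sup>2"
    using ineq[of 0 x 0] x d[of x] \<open>\<epsilon> > 0\<close> by (simp add: \<delta>_def)
  moreover have "(m - 1) * x \<le> ?f x"
    using oscillating_abs_ge[of m x n] x by simp
  ultimately have "(m - 1) * x \<le> \<rho> / 2 * x * x"
    by (simp add: power2_eq_square)
  \<comment> \<open>Cancelling the positive factor \<open>x\<close> sets linear growth against a
    quadratic bound.\<close>
  then have "m - 1 \<le> \<rho> / 2 * x"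
    using x(1) by (rule mult_right_le_imp_le)
  moreover have "x * (\<rho> + 1) < m - 1"
    using x(2) \<open>\<rho> \<ge> 0\<close> by (simp add: \<delta>_def field_simps)
  moreover have "0 \<le> x * \<rho>"
    using x(1) \<open>\<rho> \<ge> 0\<close> by simp
  ultimately show False
    using x(1) by (simp add: algebra_simps)
qed

theorem mainTheorem4:
  fixes m n C :: real and f :: "real \<Rightarrow> real"
  assumes "m > 1" and "n \<noteq> 0"
    and "\<And>x. x \<noteq> 0 \<Longrightarrow> f x = \<bar>x\<bar> * (m + sin (1 / (n * x)))"
    and "f 0 = 0"
    and "C = m - 1"
  shows "C > 0 \<and>
    (\<forall>lam>0. \<forall>x. \<bar>x\<bar> < C * lam \<longrightarrow>
       proximal_map lam f x = {0} \<and> moreau_envelope lam f x = 1 / (2 * lam) * x\<^sup>2) \<and>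
    (\<forall>lam>0. lipschitz_around (proximal_map lam f) 0 \<and>
       differentiable_around (moreau_envelope lam f) 0) \<and>
    {-C..C} \<subseteq> regular_subgradients f 0 \<and>
    limiting_subgradients f 0 = UNIV \<and>
    0 \<in> limiting_subgradients f 0 \<and> \<not> prox_regular f 0 0"
proof -
  have f: "f = oscillating_abs m n"
  proof
    show "f x = oscillating_abs m n x" for x
      using assms(3,4) by (cases "x = 0") (auto simp: oscillating_abs_def)
  qed
  have ge: "C * \<bar>w\<bar> \<le> f w" for w
    using oscillating_abs_ge f assms(5) by simp
  have "C > 0"
    using assms by simp
  moreover have "limiting_subgradients f 0 = UNIV" "\<not> prox_regular f 0 0"
    using limiting_subgradients_oscillating_abs_0 not_prox_regular_oscillating_abs f assms(1,2)
    by auto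
  ultimately show ?thesis
    using sharp_minimum_proximal_map[OF assms(4) ge] sharp_minimum_moreau_envelope[OF assms(4) ge]
      sharp_minimum_lipschitz_around[OF assms(4) ge] sharp_minimum_differentiable_around[OF assms(4) ge]
      sharp_minimum_regular_subgradients[OF assms(4) ge]
    by blast
qed

end
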